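(* Let $H=\langle a,b\rangle$ be a group acting on a set $X$, and let $F_2$ be the free group generated by the symbols $\overline{a}$ and $\overline{b}$. Let $X_1,X_2\subseteq X$ be disjoint, and let $K_i\subseteq X_i$ be nonempty for $i=1,2$. Denote $$W_{X\to K}=W(X_1,X_2,K_1,K_2)\subseteq F_2\qquad\text{and}\qquad W_{K\to X}=W(K_1,K_2,X_1,X_2)\subseteq F_2.$$ Then every relator of $H$ whose first and last letters are identical (up to inversion) has an exact subword that belongs to $\mathcal{F}(W_{X\to K})\setminus W_{K\to X}$. If in addition there exists $N\in\mathbb{N}$ such that $\overline{a}^k\in W_{X\to K}$ for every integer $k$ with $|k|\ge N$, then the assumption on the first and last letters of the relator can be dropped.
   Context: For $\overline{w}=\overline{w}(\overline{a},\overline{b})\in F_2$, write $w=\overline{w}(a,b)\in H$ for its image under $\overline{a}\mapsto a$, $\overline{b}\mapsto b$. A relator of $H$ is a nonempty reduced word $\overline{w}\in F_2$ with $w=1$ in $H$. If $s_1^{n_1}\cdots s_k^{n_k}$ is a reduced word (with $s_j\in\{\overline{a},\overline{b}\}$, $s_j\ne s_{j+1}$, $n_j\in\mathbb{Z}\setminus\{0\}$), its syllables are the $s_j^{n_j}$, and an exact subword is any nonempty subword composed of consecutive full syllables, i.e. $s_i^{n_i}\cdots s_j^{n_j}$ with $i\le j$. For $W\subseteq F_2$, $\mathcal{F}(W)$ is the set of all nonempty $\overline{w}\in F_2$ such that no exact subword of $\overline{w}$ belongs to $W$. For $x,y\in\{a,b\}$, $F_2^{\overline{x},\overline{y}}$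 is the set of nonempty reduced words whose first letter is $\overline{x}^{\pm1}$ and whose last letter is $\overline{y}^{\pm1}$. For $C_1,C_2,D_1,D_2\subseteq X$, $W(C_1,C_2,D_1,D_2)\subseteq F_2$ is the set of all $\overline{w}\in F_2$ such that: $w(C_1)\subseteq D_2$ if $\overline{w}\in F_2^{\overline{a},\overline{a}}$; $w(C_2)\subseteq D_2$ if $\overline{w}\in F_2^{\overline{a},\overline{b}}$; $w(C_1)\subseteq D_1$ if $\overline{w}\in F_2^{\overline{b},\overline{a}}$; $w(C_2)\subseteq D_1$ if $\overline{w}\in F_2^{\overline{b},\overline{b}}$. "First and last letters identical (up to inversion)" means the relator lies in $F_2^{\overline{a},\overline{a}}\cup F_2^{\overline{b},\overline{b}}$. *)

theory Defs
  imports "HOL-Algebra.Group_Action" "HOL-Algebra.Generated_Groups" "HOL-Library.Sublist"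
begin

datatype letter = La | Lb

text \<open>
  An element of the free group \<open>F\<^sub>2\<close> is represented by the list of syllables of its reduced word:
  \<open>[(s\<^sub>1, n\<^sub>1), \<dots>, (s\<^sub>k, n\<^sub>k)]\<close> stands for \<open>s\<^sub>1\<^bsup>n\<^sub>1\<^esup> \<cdots> s\<^sub>k\<^bsup>n\<^sub>k\<^esup>\<close>.
\<close>

type_synonym word = "(letter \<times> int) list"

definition reduced :: "word \<Rightarrow> bool" where
  "reduced w \<longleftrightarrow> (\<forall>p \<in> set w. snd p \<noteq> 0) \<and> successively (\<lambda>p q. fst p \<noteq> fst q) w"

text \<open>Left multiplication of a reduced word by a power of a letter, followed by reduction.\<close>

fun lmul :: "letter \<times> int \<Rightarrow> word \<Rightarrow> word" where
  "lmul (s, n) [] = (if n = 0 then [] else [(s, n)])"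
| "lmul (s, n) ((t, m) # w) =
    (if n = 0 then (t, m) # w
     else if s = t then (if n + m = 0 then w else (s, n + m) # w)
     else (s, n) # (t, m) # w)"

definition F2 :: "word monoid" where
  "F2 = \<lparr>carrier = {w. reduced w}, mult = (\<lambda>u v. foldr lmul u v), one = []\<rparr>"

definition gen :: "letter \<Rightarrow> word" where
  "gen s = [(s, 1)]"

text \<open>The image in \<open>H\<close> of a word under the substitution of \<open>a\<close> for \<open>La\<close> and \<open>b\<close> for \<open>Lb\<close>.\<close>

fun letter_val :: "'h \<Rightarrow> 'h \<Rightarrow> letter \<Rightarrow> 'h" where
  "letter_val a b La = a"
| "letter_val a b Lb = b"

definition word_val :: "('h, 'm) monoid_scheme \<Rightarrow> 'h \<Rightarrow> 'h \<Rightarrow> word \<Rightarrow> 'h" where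
  "word_val H a b w =
     foldr (\<lambda>(s, n) h. (letter_val a b s [^]\<^bsub>H\<^esub> n) \<otimes>\<^bsub>H\<^esub> h) w \<one>\<^bsub>H\<^esub>"

definition relator :: "('h, 'm) monoid_scheme \<Rightarrow> 'h \<Rightarrow> 'h \<Rightarrow> word \<Rightarrow> bool" where
  "relator H a b w \<longleftrightarrow> w \<in> carrier F2 \<and> w \<noteq> [] \<and> word_val H a b w = \<one>\<^bsub>H\<^esub>"

text \<open>As words are lists of syllables, contiguous sublists consist of full syllables.\<close>

definition exact_subword :: "word \<Rightarrow> word \<Rightarrow> bool" where
  "exact_subword u w \<longleftrightarrow> u \<noteq> [] \<and> sublist u w"

definition exact_free :: "word set \<Rightarrow> word set" where
  "exact_free W = {w \<in> carrier F2. w \<noteq> [] \<and> \<not> (\<exists>u. exact_subword u w \<and> u \<in> W)}"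

definition F2_between :: "letter \<Rightarrow> letter \<Rightarrow> word set" where
  "F2_between x y = {w \<in> carrier F2. w \<noteq> [] \<and> fst (hd w) = x \<and> fst (last w) = y}"

definition W_set ::
  "('h, 'm) monoid_scheme \<Rightarrow> 'h \<Rightarrow> 'h \<Rightarrow> ('h \<Rightarrow> 'x \<Rightarrow> 'x) \<Rightarrow>
     'x set \<Rightarrow> 'x set \<Rightarrow> 'x set \<Rightarrow> 'x set \<Rightarrow> word set" where
  "W_set H a b \<phi> C1 C2 D1 D2 =
     {w \<in> carrier F2.
        (w \<in> F2_between La La \<longrightarrow> \<phi> (word_val H a b w) ` C1 \<subseteq> D2) \<and>
        (w \<in> F2_between La Lb \<longrightarrow> \<phi> (word_val H a b w) ` C2 \<subseteq> D2) \<and>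
        (w \<in> F2_between Lb La \<longrightarrow> \<phi> (word_val H a b w) ` C1 \<subseteq> D1) \<and>
        (w \<in> F2_between Lb Lb \<longrightarrow> \<phi> (word_val H a b w) ` C2 \<subseteq> D1)}"

text \<open>
  The following facts say that \<open>F2\<close> is a group which is free on \<open>gen La\<close> and \<open>gen Lb\<close>: these
  elements generate it, and \<open>word_val H a b\<close> is a homomorphism that sends them to \<open>a\<close> and \<open>b\<close>.
\<close>

lemma reduced_Nil: "reduced []"
  by (simp add: reduced_def)

lemma reduced_Cons:
  "reduced ((s, n) # w) \<longleftrightarrow> n \<noteq> 0 \<and> reduced w \<and> (w \<noteq> [] \<longrightarrow> s \<noteq> fst (hd w))"
  by (cases w) (auto simp: reduced_def)

lemma reduced_lmul: "reduced w \<Longrightarrow> reduced (lmul p w)"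
  by (induction p w rule: lmul.induct) (auto simp: reduced_Cons reduced_Nil)

lemma lmul_zero: "lmul (s, 0) w = w"
  by (cases w) auto

lemma lmul_lmul: "reduced w \<Longrightarrow> lmul (s, n) (lmul (s, m) w) = lmul (s, n + m) w"
proof (cases w)
  case (Cons p v)
  then show "reduced w \<Longrightarrow> ?thesis"
    by (cases p; cases v) (auto simp: reduced_Cons lmul_zero)
qed simp

lemma lmul_reduced_Cons: "reduced (p # w) \<Longrightarrow> lmul p w = p # w"
  by (cases p; cases w) (auto simp: reduced_Cons)

lemma reduced_foldr_lmul: "reduced v \<Longrightarrow> reduced (foldr lmul u v)"
  by (induction u) (auto simp: reduced_lmul)

lemma foldr_lmul_lmul:
  "reduced u \<Longrightarrow> reduced v \<Longrightarrow> foldr lmul (lmul p u) v = lmul p (foldr lmul u v)"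
  by (induction p u rule: lmul.induct)
    (auto simp: reduced_Cons lmul_zero lmul_lmul reduced_foldr_lmul)

lemma foldr_lmul_assoc:
  "reduced v \<Longrightarrow> reduced w \<Longrightarrow>
     foldr lmul (foldr lmul u v) w = foldr lmul u (foldr lmul v w)"
  by (induction u) (auto simp: foldr_lmul_lmul reduced_foldr_lmul)

lemma foldr_lmul_Nil: "reduced w \<Longrightarrow> foldr lmul w [] = w"
proof (induction w)
  case (Cons p w)
  then have "reduced w" by (cases p) (simp add: reduced_Cons)
  with Cons show ?case by (simp add: lmul_reduced_Cons)
qed simp

lemma foldr_lmul_inverse:
  "reduced w \<Longrightarrow> \<exists>v. reduced v \<and> foldr lmul v w = []"
proof (induction w)
  case Nil
  then show ?case by (intro exI[of _ "[]"]) (simp add: reduced_Nil)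
next
  case (Cons p w)
  obtain s n where p: "p = (s, n)" by (cases p)
  have w: "reduced w" and n: "n \<noteq> 0" using Cons.prems by (auto simp: p reduced_Cons)
  obtain v where v: "reduced v" "foldr lmul v w = []" using Cons.IH w by blast
  let ?u = "[(s, - n)]"
  have u: "reduced ?u" using n by (simp add: reduced_Cons reduced_Nil)
  have "foldr lmul (foldr lmul v ?u) (p # w) = foldr lmul v (lmul (s, - n) (p # w))"
    using foldr_lmul_assoc[OF u Cons.prems] by simp
  also have "lmul (s, - n) (p # w) = w" using n by (simp add: p)
  finally show ?case using v(2) reduced_foldr_lmul[OF u] by metis
qed

lemma group_F2: "group F2"
  by (rule groupI)
    (auto simp: F2_def reduced_Nil reduced_foldr_lmul foldr_lmul_assoc foldr_lmul_inverse)

lemma gen_carrier: "gen s \<in> carrier F2"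
  by (simp add: F2_def gen_def reduced_Cons reduced_Nil)

lemma gen_nat_pow: "gen s [^]\<^bsub>F2\<^esub> (k::nat) = (if k = 0 then [] else [(s, int k)])"
  by (induction k) (auto simp: F2_def gen_def nat_pow_def)

lemma gen_int_pow: "gen s [^]\<^bsub>F2\<^esub> (k::int) = (if k = 0 then [] else [(s, k)])"
proof (cases "k \<ge> 0")
  case True
  then show ?thesis by (simp add: int_pow_def2 gen_nat_pow)
next
  case False
  interpret group F2 by (rule group_F2)
  have "inv\<^bsub>F2\<^esub> [(s, - k)] = [(s, k)]"
    using False by (intro inv_equality) (auto simp: F2_def reduced_Cons reduced_Nil)
  with False show ?thesis by (simp add: int_pow_def2 gen_nat_pow)
qed

lemma generate_F2: "generate F2 {gen La, gen Lb} = carrier F2"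
proof
  interpret group F2 by (rule group_F2)
  let ?S = "generate F2 {gen La, gen Lb}"
  show "?S \<subseteq> carrier F2" by (intro generate_incl) (auto simp: gen_carrier)
  have sub: "subgroup ?S F2" by (intro generate_is_subgroup) (auto simp: gen_carrier)
  have pow: "gen s [^]\<^bsub>F2\<^esub> (n::int) \<in> ?S" for s n
  proof -
    have "gen s \<in> ?S" by (cases s) (auto intro: generate.incl)
    then show ?thesis using subgroup_int_pow_closed[OF sub] by simp
  qed
  have "w \<in> ?S" if "reduced w" for w
    using that
  proof (induction w)
    case Nil
    then show ?case using generate.one[of F2] by (simp add: F2_def)
  next
    case (Cons p w)
    obtain s n where p: "p = (s, n)" by (cases p)
    have w: "reduced w" and n: "n \<noteq> 0" using Cons.prems by (auto simp: p reduced_Cons)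
    have "gen s [^]\<^bsub>F2\<^esub> n \<otimes>\<^bsub>F2\<^esub> w \<in> ?S" using pow Cons.IH[OF w] by (rule generate.eng)
    moreover have "gen s [^]\<^bsub>F2\<^esub> n \<otimes>\<^bsub>F2\<^esub> w = p # w"
      unfolding gen_int_pow using n lmul_reduced_Cons[OF Cons.prems] by (simp add: F2_def p)
    ultimately show ?case by simp
  qed
  then show "carrier F2 \<subseteq> ?S" by (auto simp: F2_def)
qed

context
  fixes H (structure) and a b
  assumes H: "group H" and ab: "a \<in> carrier H" "b \<in> carrier H"
begin

lemma letter_val_carrier: "letter_val a b s \<in> carrier H"
  using ab by (cases s) auto

lemma word_val_carrier: "word_val H a b w \<in> carrier H"
proof -
  interpret group H by (rule H)
  show ?thesis by (induction w) (auto simp: word_val_def letter_val_carrier)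
qed

lemma word_val_Cons: "word_val H a b ((s, n) # w) = (letter_val a b s [^] n) \<otimes> word_val H a b w"
  by (simp add: word_val_def)

lemma word_val_lmul:
  "word_val H a b (lmul (s, n) w) = (letter_val a b s [^] n) \<otimes> word_val H a b w"
proof -
  interpret group H by (rule H)
  note [simp] = letter_val_carrier word_val_carrier word_val_Cons
  show ?thesis
  proof (cases w)
    case Nil
    then show ?thesis by (simp add: word_val_def letter_val_carrier)
  next
    case (Cons q v)
    obtain t m where q: "q = (t, m)" by (cases q)
    have *: "(letter_val a b s [^] n) \<otimes> ((letter_val a b s [^] m) \<otimes> word_val H a b v)
        = (letter_val a b s [^] (n + m)) \<otimes> word_val H a b v"
      by (simp add: int_pow_mult m_assoc)
    show ?thesis
      using * by (auto simp: Cons q)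
  qed
qed

lemma word_val_hom: "word_val H a b \<in> hom F2 H"
proof -
  interpret group H by (rule H)
  have "word_val H a b (foldr lmul u v) = word_val H a b u \<otimes> word_val H a b v" for u v
  proof (induction u)
    case Nil
    then show ?case using word_val_carrier by (simp add: word_val_def[of H a b "[]"])
  next
    case (Cons p u)
    then show ?case
      by (cases p) (simp add: word_val_lmul word_val_Cons m_assoc letter_val_carrier word_val_carrier)
  qed
  then show ?thesis by (auto simp: hom_def F2_def word_val_carrier)
qed

lemma word_val_gen: "word_val H a b (gen s) = letter_val a b s"
proof -
  interpret group H by (rule H)
  show ?thesis by (simp add: gen_def word_val_def letter_val_carrier)
qed

end

end

theory Submission
  imports Defs
begin

text \<open>
  The proof is a ping-pong argument. Membership of a nonempty word \<open>w\<close> in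
  \<open>W(C\<^sub>1, C\<^sub>2, D\<^sub>1, D\<^sub>2)\<close> says that \<open>w\<close> maps a set \<open>C\<^sub>i\<close> determined by its last letter into a set
  \<open>D\<^sub>j\<close> determined by its first letter, and the indices are chosen such that the maps of adjacent
  exact subwords compose: if \<open>u v\<close> is reduced, then the last letter of \<open>u\<close> differs from the first
  letter of \<open>v\<close>, so \<open>u\<close> starts where \<open>v\<close> ends (\<open>W_set_append\<close>).

  Suppose that each exact subword of \<open>w\<close> in \<open>\<F>(W\<^bsub>X\<rightarrow>K\<^esub>)\<close> belongs to \<open>W\<^bsub>K\<rightarrow>X\<^esub>\<close>. Then \<open>w\<close> itself
  belongs to \<open>W\<^bsub>K\<rightarrow>X\<^esub>\<close> (\<open>W_set_of_exact_free_subwords\<close>). If no exact subword of \<open>w\<close> is in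
  \<open>W\<^bsub>X\<rightarrow>K\<^esub>\<close>, this is the hypothesis for \<open>w\<close> itself. Otherwise \<open>w = x v y\<close> with \<open>v\<close> in \<open>W\<^bsub>X\<rightarrow>K\<^esub>\<close>,
  and inductively \<open>y\<close> maps \<open>K\<close> into \<open>X\<close>, which \<open>v\<close> maps into \<open>K\<close>, which \<open>x\<close> maps into \<open>X\<close>.

  A word with first and last letter \<open>a\<close> that belongs to \<open>W\<^bsub>K\<rightarrow>X\<^esub>\<close> maps \<open>K\<^sub>1\<close> into \<open>X\<^sub>2\<close>. It does not
  act trivially, as \<open>K\<^sub>1 \<subseteq> X\<^sub>1\<close> is nonempty and \<open>X\<^sub>1\<close> and \<open>X\<^sub>2\<close> are disjoint. The letter \<open>b\<close> is symmetric.

  A relator whose first and last letters differ is \<open>a\<^sup>n y\<close> or \<open>y a\<^sup>n\<close> where \<open>y\<close> begins and ends with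
  \<open>b\<close>. If it violates the claim, then \<open>y\<close> maps \<open>K\<^sub>2\<close> into \<open>X\<^sub>1\<close>, and \<open>y = a\<^sup>-\<^sup>n\<close> in \<open>H\<close>. For
  large \<open>k\<close> both \<open>a\<^sup>k\<close> and \<open>a\<^sup>k\<^sup>-\<^sup>n\<close> map \<open>X\<^sub>1\<close> into \<open>K\<^sub>2\<close>; but \<open>a\<^sup>k\<^sup>-\<^sup>n = y a\<^sup>k\<close> in \<open>H\<close> maps \<open>X\<^sub>1\<close>
  into \<open>X\<^sub>1\<close>, a contradiction.
\<close>

section \<open>Reduced words and their values\<close>

lemma F2_carrier_iff: "w \<in> carrier F2 \<longleftrightarrow> reduced w"
  by (simp add: F2_def)

lemma reduced_append_iff:
  "reduced (u @ v) \<longleftrightarrow>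
     reduced u \<and> reduced v \<and> (u \<noteq> [] \<and> v \<noteq> [] \<longrightarrow> fst (last u) \<noteq> fst (hd v))"
  by (auto simp: reduced_def successively_append_iff)

lemma word_val_append:
  assumes "group H" "a \<in> carrier H" "b \<in> carrier H"
  shows "word_val H a b (u @ v) = word_val H a b u \<otimes>\<^bsub>H\<^esub> word_val H a b v"
proof -
  interpret group H by fact
  note [simp] = word_val_carrier[OF assms] letter_val_carrier[OF assms]
  show ?thesis
  proof (induction u)
    case Nil
    then show ?case by (simp add: word_val_def[of H a b "[]"])
  next
    case (Cons p u)
    then show ?case by (cases p) (simp add: word_val_Cons[OF assms] m_assoc)
  qed
qed

lemma word_val_syllable:
  assumes "group H" "a \<in> carrier H" "b \<in> carrier H"
  shows "word_val H a b [(s, n)] = letter_val a b s [^]\<^bsub>H\<^esub> n"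
proof -
  interpret group H by fact
  show ?thesis by (simp add: word_val_def letter_val_carrier[OF assms])
qed

text \<open>
  Exactly one end of such a relator is a power of \<open>a\<close>. Whether it is the left or the right end,
  removing it leaves a word with the value of the inverse power, as a one-sided inverse in a group
  is two-sided; so the two cases need not be told apart later on.
\<close>

lemma relator_split_power:
  assumes H: "group H" "a \<in> carrier H" "b \<in> carrier H"
    and w: "relator H a b w" "fst (hd w) \<noteq> fst (last w)"
  obtains y n where "sublist y w" "y \<in> F2_between Lb Lb" "word_val H a b y = a [^]\<^bsub>H\<^esub> (- n :: int)"
proof -
  interpret group H by (rule H)
  have red: "reduced w" and ne: "w \<noteq> []" and val: "word_val H a b w = \<one>\<^bsub>H\<^esub>"
    using w(1) by (auto simp: relator_def F2_carrier_iff)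
  note car = word_val_carrier[OF H]
  have neq_La: "s = Lb" if "s \<noteq> La" for s using that by (cases s) auto
  show thesis
  proof (cases "fst (hd w) = La")
    case True
    then obtain n y where wy: "w = (La, n) # y" using ne by (cases w) auto
    have y: "y \<noteq> []" using w(2) wy by auto
    have "fst (hd y) = Lb" "fst (last y) = Lb"
      using red w(2) y by (auto simp: wy reduced_Cons neq_La)
    then have "y \<in> F2_between Lb Lb"
      using red y by (auto simp: F2_between_def F2_carrier_iff wy reduced_Cons)
    moreover have "a [^]\<^bsub>H\<^esub> n \<otimes>\<^bsub>H\<^esub> word_val H a b y = \<one>\<^bsub>H\<^esub>"
      using val by (simp add: wy word_val_Cons[OF H])
    then have "word_val H a b y = inv\<^bsub>H\<^esub> (a [^]\<^bsub>H\<^esub> n)"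
      using H(2) car by (metis inv_equality inv_inv int_pow_closed)
    ultimately show thesis
      using that[of y n] H(2) by (auto simp: wy int_pow_neg sublist_Cons_right)
  next
    case False
    then have hd: "fst (hd w) = Lb" and "fst (last w) = La"
      using w(2) neq_La by (cases "fst (last w)"; auto)+
    then obtain n y where wy: "w = y @ [(La, n)]"
      using ne by (cases w rule: rev_cases) auto
    have y: "y \<noteq> []" using hd wy by auto
    have "fst (hd y) = Lb" "fst (last y) = Lb"
      using red hd y by (auto simp: wy reduced_append_iff neq_La)
    then have "y \<in> F2_between Lb Lb"
      using red y by (auto simp: F2_between_def F2_carrier_iff wy reduced_append_iff)
    moreover have "word_val H a b y \<otimes>\<^bsub>H\<^esub> a [^]\<^bsub>H\<^esub> n = \<one>\<^bsub>H\<^esub>"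
      using val by (simp add: wy word_val_append[OF H] word_val_syllable[OF H])
    then have "word_val H a b y = inv\<^bsub>H\<^esub> (a [^]\<^bsub>H\<^esub> n)"
      using H(2) car by (metis inv_equality int_pow_closed)
    ultimately show thesis
      using that[of y n] H(2) by (auto simp: wy int_pow_neg)
  qed
qed

section \<open>Ping-pong\<close>

text \<open>
  With \<open>at_letter\<close> the four cases in the definition of \<open>W_set\<close> become one: a word takes
  \<open>at_letter C1 C2\<close> of its last letter to \<open>at_letter D2 D1\<close> of its first letter. The interchange
  of \<open>D1\<close> and \<open>D2\<close> is what makes reduced products composable.
\<close>

fun at_letter :: "'x set \<Rightarrow> 'x set \<Rightarrow> letter \<Rightarrow> 'x set" where
  "at_letter C1 C2 La = C1"
| "at_letter C1 C2 Lb = C2"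

lemma at_letter_neq: "s \<noteq> t \<Longrightarrow> at_letter C2 C1 s = at_letter C1 C2 t"
  by (cases s; cases t) auto

lemma at_letter_mono: "C1 \<subseteq> D1 \<Longrightarrow> C2 \<subseteq> D2 \<Longrightarrow> at_letter C1 C2 s \<subseteq> at_letter D1 D2 s"
  by (cases s) auto

lemma W_set_iff:
  assumes "w \<noteq> []"
  shows "w \<in> W_set H a b \<phi> C1 C2 D1 D2 \<longleftrightarrow>
    reduced w \<and>
    \<phi> (word_val H a b w) ` at_letter C1 C2 (fst (last w)) \<subseteq> at_letter D2 D1 (fst (hd w))"
  using assms
  by (cases "fst (hd w)"; cases "fst (last w)")
    (auto simp: W_set_def F2_between_def F2_carrier_iff)

lemma W_set_mono:
  assumes "w \<in> W_set H a b \<phi> C1 C2 D1 D2" "w \<noteq> []"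
    and "C1' \<subseteq> C1" "C2' \<subseteq> C2" "D1 \<subseteq> D1'" "D2 \<subseteq> D2'"
  shows "w \<in> W_set H a b \<phi> C1' C2' D1' D2'"
  using assms(1) image_mono[OF at_letter_mono[OF assms(3,4)]] at_letter_mono[OF assms(6,5)]
  unfolding W_set_iff[OF assms(2)] by (meson order_trans)

lemma W_set_append:
  assumes H: "a \<in> carrier H" "b \<in> carrier H" and act: "group_action H X \<phi>"
    and B: "B1 \<subseteq> X" "B2 \<subseteq> X"
    and u: "u \<in> W_set H a b \<phi> C1 C2 D1 D2" "u \<noteq> []"
    and v: "v \<in> W_set H a b \<phi> B1 B2 C1 C2" "v \<noteq> []"
    and red: "reduced (u @ v)"
  shows "u @ v \<in> W_set H a b \<phi> B1 B2 D1 D2"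
proof -
  interpret group_action H X \<phi> by fact
  have grp: "group H" using group_hom by (simp add: group_hom_def)
  have C: "at_letter C2 C1 (fst (hd v)) = at_letter C1 C2 (fst (last u))"
    using red u(2) v(2) by (intro at_letter_neq) (auto simp: reduced_append_iff)
  have "at_letter B1 B2 s \<subseteq> X" for s using B by (cases s) auto
  then have "\<phi> (word_val H a b (u @ v)) x = \<phi> (word_val H a b u) (\<phi> (word_val H a b v) x)"
    if "x \<in> at_letter B1 B2 (fst (last v))" for x
    using that word_val_carrier[OF grp H]
    by (auto simp: word_val_append[OF grp H] intro: composition_rule)
  then show ?thesis
    using u v red C by (auto simp: W_set_iff image_subset_iff)
qed

text \<open>
  Since \<open>K \<subseteq> X\<close>, an exact subword in \<open>W\<^bsub>X\<rightarrow>K\<^esub>\<close> absorbs whatever is on its right: the product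
  even belongs to \<open>W\<^bsub>K\<rightarrow>K\<^esub>\<close>, and a shorter word in \<open>W\<^bsub>K\<rightarrow>X\<^esub>\<close> can then be put on its left.
  This allows an induction on length that splits at an arbitrary such subword.
\<close>

lemma W_set_of_exact_free_subwords:
  fixes K1 K2 X1 X2 :: "'x set"
  assumes H: "a \<in> carrier H" "b \<in> carrier H" and act: "group_action H X \<phi>"
    and sub: "K1 \<subseteq> X1" "K2 \<subseteq> X2" "X1 \<subseteq> X" "X2 \<subseteq> X"
    and w: "reduced w" "w \<noteq> []"
    and free: "\<And>u. exact_subword u w \<Longrightarrow> u \<in> exact_free (W_set H a b \<phi> X1 X2 K1 K2)
                 \<Longrightarrow> u \<in> W_set H a b \<phi> K1 K2 X1 X2"
  shows "w \<in> W_set H a b \<phi> K1 K2 X1 X2"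
  using w free
proof (induction w rule: length_induct)
  case (1 w)
  let ?XK = "W_set H a b \<phi> X1 X2 K1 K2" and ?KX = "W_set H a b \<phi> K1 K2 X1 X2"
  let ?KK = "W_set H a b \<phi> K1 K2 K1 K2"
  have K: "K1 \<subseteq> X" "K2 \<subseteq> X" using sub by auto
  have IH: "z \<in> ?KX" if "sublist z w" "length z < length w" "z \<noteq> []" for z
  proof -
    have "reduced z" using that(1) "1.prems"(1) by (auto simp: sublist_def reduced_append_iff)
    moreover have "exact_subword u w" if "exact_subword u z" for u
      using that \<open>sublist z w\<close> by (auto simp: exact_subword_def intro: sublist_order.order_trans)
    ultimately show ?thesis using "1.IH" "1.prems"(3) that by blast
  qed
  show ?case
  proof (cases "\<exists>v. exact_subword v w \<and> v \<in> ?XK")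
    case False
    then have "w \<in> exact_free ?XK"
      using "1.prems" by (auto simp: exact_free_def F2_carrier_iff)
    then show ?thesis using "1.prems" by (simp add: exact_subword_def)
  next
    case True
    then obtain x v y where v: "v \<in> ?XK" "v \<noteq> []" and wxy: "w = x @ v @ y"
      by (auto simp: exact_subword_def sublist_def)
    have red: "reduced (v @ y)"
      using "1.prems"(1) unfolding wxy by (simp only: reduced_append_iff[of x])
    have vy: "v @ y \<in> ?KK"
    proof (cases "y = []")
      case True
      then show ?thesis using W_set_mono[OF v] sub by simp
    next
      case False
      have "sublist y w" using sublist_append_leftI[of y "x @ v"] by (simp add: wxy)
      moreover have "length y < length w" using v(2) by (simp add: wxy)
      ultimately have "y \<in> ?KX" using IH False by blast
      then show ?thesis by (rule W_set_append[OF H act K v _ False red])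
    qed
    show ?thesis
    proof (cases "x = []")
      case True
      then have "w = v @ y" by (simp add: wxy)
      then show ?thesis using W_set_mono[OF vy] sub v(2) by blast
    next
      case False
      have "sublist x w" "length x < length w" using v(2) by (simp_all add: wxy)
      then have "x \<in> ?KX" using IH False by blast
      moreover have "v @ y \<noteq> []" "reduced (x @ v @ y)"
        using v(2) "1.prems"(1) by (simp_all add: wxy)
      ultimately show ?thesis
        unfolding wxy by (intro W_set_append[OF H act K _ False vy])
    qed
  qed
qed

section \<open>Relators\<close>

theorem proposition2p5:
  fixes H :: "('h, 'm) monoid_scheme"
    and a b :: 'h
    and X X1 X2 K1 K2 :: "'x set"
    and \<phi> :: "'h \<Rightarrow> 'x \<Rightarrow> 'x"
    and W_XK W_KX :: "word set"
  assumes "group H"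
    and "a \<in> carrier H" and "b \<in> carrier H"
    and "generate H {a, b} = carrier H"
    and "group_action H X \<phi>"
    and "X1 \<subseteq> X" and "X2 \<subseteq> X" and "X1 \<inter> X2 = {}"
    and "K1 \<subseteq> X1" and "K1 \<noteq> {}" and "K2 \<subseteq> X2" and "K2 \<noteq> {}"
  defines "W_XK \<equiv> W_set H a b \<phi> X1 X2 K1 K2"
    and "W_KX \<equiv> W_set H a b \<phi> K1 K2 X1 X2"
  shows "(\<forall>w. relator H a b w \<and> w \<in> F2_between La La \<union> F2_between Lb Lb
             \<longrightarrow> (\<exists>u. exact_subword u w \<and> u \<in> exact_free W_XK - W_KX))
       \<and> ((\<exists>N::nat. \<forall>k::int. \<bar>k\<bar> \<ge> int N \<longrightarrow> gen La [^]\<^bsub>F2\<^esub> k \<in> W_XK)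
             \<longrightarrow> (\<forall>w. relator H a b w
                    \<longrightarrow> (\<exists>u. exact_subword u w \<and> u \<in> exact_free W_XK - W_KX)))"
proof -
  interpret group_action H X \<phi> by fact
  interpret group H by fact
  note H = \<open>group H\<close> \<open>a \<in> carrier H\<close> \<open>b \<in> carrier H\<close>
  have K_to_X: "y \<in> W_KX"
    if w: "reduced w" and y: "sublist y w" "y \<noteq> []"
      and none: "\<nexists>u. exact_subword u w \<and> u \<in> exact_free W_XK - W_KX" for w y
  proof -
    have "reduced y" using w y(1) by (auto simp: sublist_def reduced_append_iff)
    moreover have "exact_subword u w" if "exact_subword u y" for u
      using that y(1) by (auto simp: exact_subword_def intro: sublist_order.order_trans)
    ultimately show ?thesis
      using W_set_of_exact_free_subwords[of a H b X \<phi> K1 X1 K2 X2 y] assms y(2) none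
      by blast
  qed
  have same: "\<exists>u. exact_subword u w \<and> u \<in> exact_free W_XK - W_KX"
    if rel: "relator H a b w" and eq: "fst (hd w) = fst (last w)" for w
  proof (rule ccontr)
    assume none: "\<nexists>u. exact_subword u w \<and> u \<in> exact_free W_XK - W_KX"
    have w: "reduced w" "w \<noteq> []" "word_val H a b w = \<one>\<^bsub>H\<^esub>"
      using rel by (auto simp: relator_def F2_carrier_iff)
    let ?s = "fst (hd w)"
    have "w \<in> W_KX" using K_to_X none w by blast
    then have img: "\<phi> \<one>\<^bsub>H\<^esub> ` at_letter K1 K2 ?s \<subseteq> at_letter X2 X1 ?s"
      using w eq by (simp add: W_KX_def W_set_iff)
    obtain x where x: "x \<in> at_letter K1 K2 ?s"
      using \<open>K1 \<noteq> {}\<close> \<open>K2 \<noteq> {}\<close> by (cases ?s) auto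
    have "x \<in> at_letter X1 X2 ?s" "x \<in> X"
      using x \<open>K1 \<subseteq> X1\<close> \<open>K2 \<subseteq> X2\<close> \<open>X1 \<subseteq> X\<close> \<open>X2 \<subseteq> X\<close> by (cases ?s; auto)+
    moreover have "\<phi> \<one>\<^bsub>H\<^esub> x = x" using \<open>x \<in> X\<close> by (metis id_eq_one restrict_apply')
    then have "x \<in> at_letter X2 X1 ?s" using img x by auto
    ultimately show False using \<open>X1 \<inter> X2 = {}\<close> by (cases ?s) auto
  qed
  have different: "\<exists>u. exact_subword u w \<and> u \<in> exact_free W_XK - W_KX"
    if rel: "relator H a b w" and neq: "fst (hd w) \<noteq> fst (last w)"
      and N: "\<forall>k::int. \<bar>k\<bar> \<ge> int N \<longrightarrow> gen La [^]\<^bsub>F2\<^esub> k \<in> W_XK" for w N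
  proof (rule ccontr)
    assume none: "\<nexists>u. exact_subword u w \<and> u \<in> exact_free W_XK - W_KX"
    obtain y n where y: "sublist y w" "y \<in> F2_between Lb Lb"
      and val: "word_val H a b y = a [^]\<^bsub>H\<^esub> (- n :: int)"
      using relator_split_power[OF H rel neq] .
    have "y \<in> W_KX"
      using K_to_X none y rel by (auto simp: relator_def F2_carrier_iff F2_between_def)
    then have y_img: "\<phi> (a [^]\<^bsub>H\<^esub> (- n)) ` K2 \<subseteq> X1"
      using y(2) val by (auto simp: W_KX_def W_set_def)
    have a_img: "\<phi> (a [^]\<^bsub>H\<^esub> k) ` X1 \<subseteq> K2" if "\<bar>k\<bar> \<ge> int N" "k \<noteq> 0" for k :: int
    proof -
      have "[(La, k)] \<in> W_XK" using N that by (metis gen_int_pow)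
      then show ?thesis
        by (simp add: W_XK_def W_set_iff word_val_syllable[OF H])
    qed
    \<comment> \<open>Adding 1 keeps both exponents \<open>k\<close> and \<open>k - n\<close> away from 0 even if \<open>N = 0\<close>: the zeroth
      power is the empty word, whose membership in \<open>W_XK\<close> carries no information.\<close>
    define k where "k = int N + \<bar>n\<bar> + 1"
    obtain x where x: "x \<in> X1" using \<open>K1 \<noteq> {}\<close> \<open>K1 \<subseteq> X1\<close> by auto
    have "\<phi> (a [^]\<^bsub>H\<^esub> k) x \<in> K2" "\<phi> (a [^]\<^bsub>H\<^esub> (- n + k)) x \<in> K2"
    proof -
      have "int N \<le> \<bar>k\<bar>" "k \<noteq> 0" "int N \<le> \<bar>- n + k\<bar>" "- n + k \<noteq> 0"
        by (auto simp: k_def)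
      then show "\<phi> (a [^]\<^bsub>H\<^esub> k) x \<in> K2" "\<phi> (a [^]\<^bsub>H\<^esub> (- n + k)) x \<in> K2"
        using a_img x by blast+
    qed
    moreover have "\<phi> (a [^]\<^bsub>H\<^esub> (- n + k)) x = \<phi> (a [^]\<^bsub>H\<^esub> (- n)) (\<phi> (a [^]\<^bsub>H\<^esub> k) x)"
      using x \<open>X1 \<subseteq> X\<close> H(2) int_pow_mult[of a "- n" k] by (auto intro: composition_rule)
    ultimately show False using y_img \<open>K2 \<subseteq> X2\<close> \<open>X1 \<inter> X2 = {}\<close> by auto
  qed
  show ?thesis
    using same different by (fastforce simp: F2_between_def)
qed

end
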